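(* Let $d\ge 1$, let $\{X_{\mathbf n}:\mathbf n\in\mathbb Z^d\}$ be a stationary random field, let $\preccurlyeq$ be a translation invariant total order on $\mathbb Z^d$, let $\{v_n\}\subset\mathbb R$, and let $\{\mathbf N(n)\}\subset\mathbb N^d$ satisfy $N_l(n)\to\infty$ for every $l\in\{1,\dots,d\}$ and $N_1(n)N_2(n)\cdots N_d(n)\sim n^d$. Let $r_n\to\infty$, and call a sequence $\{k_n\}$ of positive integers admissible if $k_n\to\infty$, $k_n=o(r_n)$, and $\mathbf p(n):=(\lfloor N_1(n)/k_n\rfloor,\dots,\lfloor N_d(n)/k_n\rfloor)$ tends to infinity in every coordinate. Suppose that for every admissible $\{k_n\}$, with the corresponding $\mathbf p(n)$, $$\mathbb P\left(M_{\mathbf N(n)}\le v_n\right)=\mathbb P\left(M_{\mathbf p(n)}\le v_n\right)^{k_n^d}+o(1)\qquad (n\to\infty).$$ If $$\liminf_{n\to\infty}\mathbb P\left(M_{\mathbf N(n)}\le v_n\right)>0,$$ then for every admissible $\{k_n\}$, with the corresponding $\mathbf p(n)$, $$\mathbb P\left(M_{\mathbf N(n)}\le v_n\right)=\exp\left(-n^d\,\mathbb P\left(X_{\mathbf 0}>v_n,\ M_{A(\mathbf p(n))}\le v_n\right)\right)+o(1)\qquad (n\to\infty).$$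
   Context: Stationary means that the finite-dimensional distributions are invariant under all translations of $\mathbb Z^d$. Inequalities $\mathbf i\le\mathbf j$ between elements of $\mathbb Z^d$ are coordinatewise; $\mathbf 0=(0,\dots,0)$, $\mathbf 1=(1,\dots,1)$. For finite $A\subset\mathbb Z^d$, $M_A:=\sup\{X_{\mathbf i}:\mathbf i\in A\}$ (with $\sup\emptyset=-\infty$), and for $\mathbf n\in\mathbb N^d$, $M_{\mathbf n}:=\sup\{X_{\mathbf i}:\mathbf 1\le\mathbf i\le\mathbf n\}$. A total order $\preccurlyeq$ on $\mathbb Z^d$ is translation invariant if $\mathbf i\preccurlyeq\mathbf j$ implies $\mathbf i+\mathbf k\preccurlyeq\mathbf j+\mathbf k$ for all $\mathbf k\in\mathbb Z^d$; $\mathbf i\prec\mathbf j$ means $\mathbf i\preccurlyeq\mathbf j$ and $\mathbf i\ne\mathbf j$. For $\mathbf p\in\mathbb N^d$, $$A(\mathbf p):=\{\mathbf j\in\mathbb Z^d:\ -\mathbf p\le\mathbf j\le\mathbf p\text{ and }\mathbf 0\prec\mathbf j\}.$$ *)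

theory Defs
  imports "HOL-Probability.Probability" "HOL-Library.Landau_Symbols"
begin

text \<open>
  The lattice of \<open>d\<close>-tuples of integers is the type \<open>int ^ 'd\<close> with \<open>d = CARD('d)\<close>; its library
  order \<open>\<le>\<close> is the coordinatewise one, and \<open>0\<close> and \<open>1\<close> are the constant vectors.
\<close>

definition int_vec :: "nat ^ 'd \<Rightarrow> int ^ 'd" where
  "int_vec p = (\<chi> l. int (p $ l))"

definition stationary_field :: "'a measure \<Rightarrow> (int ^ 'd \<Rightarrow> 'a \<Rightarrow> real) \<Rightarrow> bool" where
  "stationary_field M X \<longleftrightarrow>
     (\<forall>J k. finite J \<longrightarrow>
        distr M (\<Pi>\<^sub>M i\<in>J. borel) (\<lambda>\<omega>. \<lambda>i\<in>J. X (i + k) \<omega>) =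
        distr M (\<Pi>\<^sub>M i\<in>J. borel) (\<lambda>\<omega>. \<lambda>i\<in>J. X i \<omega>))"

definition translation_invariant :: "(int ^ 'd) rel \<Rightarrow> bool" where
  "translation_invariant R \<longleftrightarrow> (\<forall>i j k. (i, j) \<in> R \<longrightarrow> (i + k, j + k) \<in> R)"

text \<open>The supremum is taken in \<open>ereal\<close>, so that it is \<open>-\<infinity>\<close> over the empty set.\<close>

definition max_on :: "(int ^ 'd \<Rightarrow> 'a \<Rightarrow> real) \<Rightarrow> (int ^ 'd) set \<Rightarrow> 'a \<Rightarrow> ereal" where
  "max_on X A \<omega> = (SUP i\<in>A. ereal (X i \<omega>))"

definition max_box :: "(int ^ 'd \<Rightarrow> 'a \<Rightarrow> real) \<Rightarrow> nat ^ 'd \<Rightarrow> 'a \<Rightarrow> ereal" where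
  "max_box X p = max_on X {i. 1 \<le> i \<and> i \<le> int_vec p}"

definition succ_box :: "(int ^ 'd) rel \<Rightarrow> nat ^ 'd \<Rightarrow> (int ^ 'd) set" where
  "succ_box R p = {j. - int_vec p \<le> j \<and> j \<le> int_vec p \<and> (0, j) \<in> R \<and> j \<noteq> 0}"

text \<open>Division on \<open>nat\<close> is the integer part of the quotient.\<close>

definition block_size :: "(nat \<Rightarrow> nat ^ 'd) \<Rightarrow> (nat \<Rightarrow> nat) \<Rightarrow> nat \<Rightarrow> nat ^ 'd" where
  "block_size N k n = (\<chi> l. (N n $ l) div k n)"

definition admissible ::
  "(nat \<Rightarrow> nat ^ 'd) \<Rightarrow> (nat \<Rightarrow> real) \<Rightarrow> (nat \<Rightarrow> nat) \<Rightarrow> bool" where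
  "admissible N r k \<longleftrightarrow>
     (\<forall>n. k n > 0) \<and>
     filterlim k at_top sequentially \<and>
     (\<lambda>n. real (k n)) \<in> o(r) \<and>
     (\<forall>l. filterlim (\<lambda>n. block_size N k n $ l) at_top sequentially)"

end

theory Submission
  imports Defs "HOL-Real_Asymp.Real_Asymp"
begin

text \<open>
  Write \<open>q(p) = \<P>(M\<^sub>p > v)\<close> and \<open>a(p) = \<P>(X\<^sub>0 > v, M\<^bsub>A(p)\<^esub> \<le> v)\<close>. Since the limit inferior is
  positive, the factorization says that \<open>k\<^sup>d q(p) = - ln \<P>(M\<^sub>N \<le> v) + o(1)\<close> for every admissible \<open>k\<close>,
  and it remains to compare \<open>k\<^sup>d q(p)\<close> with \<open>n\<^sup>d a(p)\<close>.
  The translates of the event of \<open>a(p)\<close> to the sites of \<open>[1, p]\<close> are disjoint, so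
  \<open>p\<^sub>1 \<dots> p\<^sub>d a(p) \<le> q(p)\<close>, which bounds \<open>n\<^sup>d a(p)\<close> from above.
  For the lower bound take a second admissible sequence \<open>k' = o(k)\<close>, whose blocks \<open>p'\<close> are much
  larger than \<open>p\<close>: a last exceedance in \<open>[1, p']\<close> lies at distance more than \<open>p\<close> from the
  boundary, which is controlled by \<open>a(p)\<close>, or in one of comparatively few boundary blocks of size
  \<open>p\<close>, whose contribution \<open>k'\<^sup>d \<cdot> o((k / k')\<^sup>d) \<cdot> q(p)\<close> vanishes in the limit.
\<close>

section \<open>Finite linear orders and lattice boxes\<close>

lemma finite_linear_order_has_max:
  assumes "linear_order R" "finite A" "A \<noteq> {}"
  shows "\<exists>i\<in>A. \<forall>j\<in>A. (j, i) \<in> R"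
  using assms(2,3)
proof (induction rule: finite_ne_induct)
  case (singleton x)
  then show ?case
    using assms(1) by (auto simp: order_on_defs refl_on_def)
next
  case (insert x A)
  then obtain i where i: "i \<in> A" "\<forall>j\<in>A. (j, i) \<in> R" by blast
  have R: "refl R" "trans R" "total R"
    using assms(1) by (auto simp: order_on_defs)
  show ?case
  proof (cases "(x, i) \<in> R")
    case True
    then show ?thesis using i by blast
  next
    case False
    then have "(i, x) \<in> R" "(x, x) \<in> R"
      using R(1,3) unfolding total_on_def refl_on_def by (metis UNIV_I)+
    then show ?thesis using i R(2) by (auto dest: transD)
  qed
qed

text \<open>Vectors correspond to the functions in \<open>PiE UNIV S\<close>, so counting and
  finiteness of lattice boxes reduce to the facts about \<open>PiE\<close>.\<close>

lemma vec_Pi_eq_image: "{x. \<forall>l. x $ l \<in> S l} = vec_lambda ` PiE UNIV S"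
proof -
  have "x \<in> vec_lambda ` PiE UNIV S" if "\<forall>l. x $ l \<in> S l" for x :: "'a ^ 'b"
    using that by (intro image_eqI[of _ _ "vec_nth x"]) (auto simp: PiE_UNIV_domain)
  then show ?thesis by (auto simp: PiE_UNIV_domain)
qed

lemma card_vec_Pi:
  "card {x :: 'a ^ 'd::finite. \<forall>l. x $ l \<in> S l} = (\<Prod>l\<in>UNIV. card (S l))"
  unfolding vec_Pi_eq_image
  by (subst card_image) (auto simp: inj_on_def vec_lambda_inject card_PiE)

lemma finite_vec_Pi:
  assumes "\<And>l. finite (S l)"
  shows "finite {x :: 'a ^ 'd::finite. \<forall>l. x $ l \<in> S l}"
  unfolding vec_Pi_eq_image using assms by (intro finite_imageI finite_PiE) auto

lemma box_eq: "{i. a \<le> i \<and> i \<le> b} = {i :: int ^ 'd::finite. \<forall>l. i $ l \<in> {a $ l..b $ l}}"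
  by (auto simp: less_eq_vec_def)

lemma finite_box: "finite {i :: int ^ 'd::finite. a \<le> i \<and> i \<le> b}"
  unfolding box_eq by (rule finite_vec_Pi) simp

lemma card_box: "card {i :: int ^ 'd::finite. 1 \<le> i \<and> i \<le> int_vec p} = (\<Prod>l\<in>UNIV. p $ l)"
  unfolding box_eq card_vec_Pi by (simp add: int_vec_def)

lemma finite_succ_box: "finite (succ_box R p)"
  by (rule finite_subset[OF _ finite_box[of "- int_vec p" "int_vec p"]]) (auto simp: succ_box_def)

lemma max_on_le_iff: "max_on X A \<omega> \<le> ereal c \<longleftrightarrow> (\<forall>i\<in>A. X i \<omega> \<le> c)"
  unfolding max_on_def by (simp add: SUP_le_iff)

section \<open>Exceedance events of a stationary field and their shift invariance\<close>

locale stationary_random_field = prob_space M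
  for M :: "'a measure" and X :: "int ^ 'd::finite \<Rightarrow> 'a \<Rightarrow> real" +
  assumes measurable_field [measurable]: "\<And>i. X i \<in> borel_measurable M"
    and stationary: "stationary_field M X"
begin

definition exceed :: "real \<Rightarrow> (int ^ 'd) set \<Rightarrow> 'a set" where
  "exceed c A = {\<omega> \<in> space M. \<exists>i\<in>A. X i \<omega> > c}"

text \<open>Only sites of the window \<open>i + [-p, p]\<close> are compared, so \<open>i\<close>
  need not be the \<open>R\<close>-last exceedance overall. At \<open>i = 0\<close> this is the
  event in the conclusion of the theorem.\<close>

definition last_exceed :: "real \<Rightarrow> (int ^ 'd) rel \<Rightarrow> nat ^ 'd \<Rightarrow> int ^ 'd \<Rightarrow> 'a set" where
  "last_exceed c R p i =
     {\<omega> \<in> space M. X i \<omega> > c \<and> (\<forall>j\<in>succ_box R p. X (j + i) \<omega> \<le> c)}"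

lemma sets_exceed: "finite A \<Longrightarrow> exceed c A \<in> sets M"
  unfolding exceed_def by measurable

lemma sets_last_exceed: "last_exceed c R p i \<in> sets M"
proof -
  note [simp] = finite_succ_box
  show ?thesis unfolding last_exceed_def by measurable
qed

text \<open>Both sides are masses of the cylinder set \<open>S\<close> over
  \<open>J = U \<union> V\<close>, under the laws of the shifted and of the original vector, which
  stationarity equates. Empty \<open>U\<close> serves exceedances of a box by complement,
  \<open>U = {0}\<close> serves \<open>last_exceed\<close>.\<close>

lemma prob_shift:
  assumes "finite U" "finite V"
  shows "prob {\<omega> \<in> space M. (\<forall>i\<in>U. X (i + k) \<omega> > c) \<and> (\<forall>i\<in>V. X (i + k) \<omega> \<le> c)} =
         prob {\<omega> \<in> space M. (\<forall>i\<in>U. X i \<omega> > c) \<and> (\<forall>i\<in>V. X i \<omega> \<le> c)}"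
proof -
  define J where "J = U \<union> V"
  have J: "finite J" using assms by (simp add: J_def)
  let ?P = "\<Pi>\<^sub>M i\<in>J. (borel :: real measure)"
  define S where "S = {x \<in> space ?P. (\<forall>i\<in>U. x i > c) \<and> (\<forall>i\<in>V. x i \<le> c)}"
  have comp: "(\<lambda>x. x i) \<in> borel_measurable ?P" if "i \<in> J" for i
    using that by (rule measurable_component_singleton)
  have S: "S \<in> sets ?P"
    unfolding S_def
    by (intro sets.sets_Collect_conj sets.sets_Collect_finite_All borel_measurable_less
        borel_measurable_le borel_measurable_const assms comp) (auto simp: J_def assms)
  have *: "measure (distr M ?P (\<lambda>\<omega>. \<lambda>i\<in>J. X (i + h) \<omega>)) S =
        prob {\<omega> \<in> space M. (\<forall>i\<in>U. X (i + h) \<omega> > c) \<and> (\<forall>i\<in>V. X (i + h) \<omega> \<le> c)}" for h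
  proof -
    have "(\<lambda>\<omega>. \<lambda>i\<in>J. X (i + h) \<omega>) \<in> measurable M ?P"
      by (intro measurable_restrict) simp
    then have "measure (distr M ?P (\<lambda>\<omega>. \<lambda>i\<in>J. X (i + h) \<omega>)) S =
        prob ((\<lambda>\<omega>. \<lambda>i\<in>J. X (i + h) \<omega>) -` S \<inter> space M)"
      using S by (rule measure_distr)
    also have "(\<lambda>\<omega>. \<lambda>i\<in>J. X (i + h) \<omega>) -` S \<inter> space M =
        {\<omega> \<in> space M. (\<forall>i\<in>U. X (i + h) \<omega> > c) \<and> (\<forall>i\<in>V. X (i + h) \<omega> \<le> c)}"
      by (auto simp: S_def space_PiM J_def)
    finally show ?thesis .
  qed
  have "distr M ?P (\<lambda>\<omega>. \<lambda>i\<in>J. X (i + k) \<omega>) = distr M ?P (\<lambda>\<omega>. \<lambda>i\<in>J. X (i + 0) \<omega>)"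
    using stationary J unfolding stationary_field_def by simp
  then show ?thesis using *[of k] *[of 0] by simp
qed

lemma prob_exceed_shift:
  assumes "finite A"
  shows "prob (exceed c ((\<lambda>i. i + k) ` A)) = prob (exceed c A)"
proof -
  have *: "prob (exceed c ((\<lambda>i. i + h) ` A)) =
      1 - prob {\<omega> \<in> space M. \<forall>i\<in>A. X (i + h) \<omega> \<le> c}" for h
  proof -
    have "exceed c ((\<lambda>i. i + h) ` A) = space M - {\<omega> \<in> space M. \<forall>i\<in>A. X (i + h) \<omega> \<le> c}"
      by (auto simp: exceed_def not_le)
    moreover have "{\<omega> \<in> space M. \<forall>i\<in>A. X (i + h) \<omega> \<le> c} \<in> sets M"
      using assms by measurable
    ultimately show ?thesis by (simp add: prob_compl)
  qed
  show ?thesis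
    using *[of k] *[of 0] prob_shift[of "{}" A c k] assms by simp
qed

lemma prob_last_exceed: "prob (last_exceed c R p i) = prob (last_exceed c R p 0)"
  using prob_shift[of "{0}" "succ_box R p" c i] by (simp add: last_exceed_def finite_succ_box)

lemma prob_max_box:
  "prob {\<omega> \<in> space M. max_box X p \<omega> \<le> ereal c} = 1 - prob (exceed c {i. 1 \<le> i \<and> i \<le> int_vec p})"
proof -
  have "{\<omega> \<in> space M. max_box X p \<omega> \<le> ereal c} =
      space M - exceed c {i. 1 \<le> i \<and> i \<le> int_vec p}"
    unfolding max_box_def max_on_le_iff exceed_def by (auto simp: not_less)
  then show ?thesis by (simp add: prob_compl sets_exceed finite_box)
qed

section \<open>Comparison of exceedance and last-exceedance probabilities in boxes\<close>

lemma succ_box_translate: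
  assumes "linear_order R" "translation_invariant R"
    and "(i, j) \<in> R" "i \<noteq> j" "- int_vec p \<le> j - i" "j - i \<le> int_vec p"
  shows "j - i \<in> succ_box R p"
proof -
  have "(i + (- i), j + (- i)) \<in> R"
    using assms(2,3) unfolding translation_invariant_def by blast
  then show ?thesis using assms by (auto simp: succ_box_def)
qed

text \<open>Two sites of \<open>[1, p]\<close> differ by less than \<open>p\<close> in every
  coordinate, so the \<open>R\<close>-later one lies in the window of the earlier, where
  \<open>last_exceed\<close> rules out any exceedance. The events at the sites of the box are
  therefore disjoint, and they are equally likely by stationarity.\<close>

lemma prob_exceed_box_ge:
  assumes "linear_order R" "translation_invariant R"
  shows "real (\<Prod>l\<in>UNIV. p $ l) * prob (last_exceed c R p 0)
           \<le> prob (exceed c {i. 1 \<le> i \<and> i \<le> int_vec p})"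
proof -
  define B where "B = {i :: int ^ 'd. 1 \<le> i \<and> i \<le> int_vec p}"
  have fin: "finite B" unfolding B_def by (rule finite_box)
  have later: "j - i \<in> succ_box R p" if "i \<in> B" "j \<in> B" "i \<noteq> j" "(i, j) \<in> R" for i j
  proof (rule succ_box_translate[OF assms that(4,3)])
    have "1 \<le> i $ l" "1 \<le> j $ l" "i $ l \<le> int (p $ l)" "j $ l \<le> int (p $ l)" for l
      using that(1,2) by (auto simp: B_def less_eq_vec_def int_vec_def)
    note * = this
    show "- int_vec p \<le> j - i" "j - i \<le> int_vec p"
      using * by (auto simp: less_eq_vec_def int_vec_def) (smt (verit) *)+
  qed
  have "disjoint_family_on (last_exceed c R p) B"
  proof -
    have no: "last_exceed c R p i \<inter> last_exceed c R p j = {}"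
      if "i \<in> B" "j \<in> B" "i \<noteq> j" "(i, j) \<in> R" for i j
      using later[OF that] by (force simp: last_exceed_def)
    have "(i, j) \<in> R \<or> (j, i) \<in> R" if "i \<noteq> j" for i j
      using assms(1) that by (auto simp: order_on_defs total_on_def)
    then show ?thesis unfolding disjoint_family_on_def using no by blast
  qed
  then have "prob (\<Union>i\<in>B. last_exceed c R p i) = (\<Sum>i\<in>B. prob (last_exceed c R p i))"
    using fin by (intro finite_measure_finite_Union) (auto simp: sets_last_exceed)
  also have "\<dots> = real (card B) * prob (last_exceed c R p 0)"
    by (subst prob_last_exceed) simp
  also have "card B = (\<Prod>l\<in>UNIV. p $ l)" unfolding B_def by (rule card_box)
  finally have "real (\<Prod>l\<in>UNIV. p $ l) * prob (last_exceed c R p 0) =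
      prob (\<Union>i\<in>B. last_exceed c R p i)" ..
  also have "\<dots> \<le> prob (exceed c B)"
    by (intro finite_measure_mono sets_exceed fin) (auto simp: last_exceed_def exceed_def)
  finally show ?thesis unfolding B_def .
qed

text \<open>
  The box \<open>[1, p']\<close> is covered by \<open>m\<^sub>1 \<dots> m\<^sub>d\<close> translates of \<open>[1, p]\<close>. A last exceedance in the
  covering box lies in an outermost block or is a last exceedance within range \<open>p\<close>.
\<close>

lemma prob_exceed_box_le:
  assumes "linear_order R" "translation_invariant R"
    and p': "\<And>l. p' $ l \<le> m $ l * p $ l"
  shows "prob (exceed c {i. 1 \<le> i \<and> i \<le> int_vec p'})
     \<le> (real (\<Prod>l\<in>UNIV. m $ l) - real (\<Prod>l\<in>UNIV. m $ l - 2)) *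
           prob (exceed c {i. 1 \<le> i \<and> i \<le> int_vec p})
       + real (\<Prod>l\<in>UNIV. (m $ l - 2) * p $ l) * prob (last_exceed c R p 0)"
proof -
  define B where "B = {i :: int ^ 'd. 1 \<le> i \<and> i \<le> int_vec p}"
  \<comment> \<open>\<open>Q\<close> is the covering box and \<open>I\<close> is \<open>Q\<close>
    stripped of one layer of blocks at every face. \<open>C\<close> indexes all blocks, starting
    from 0, and \<open>C0\<close> those that are not outermost.\<close>
  define Q where "Q = {i :: int ^ 'd. \<forall>l. i $ l \<in> {1..int (m $ l) * int (p $ l)}}"
  define I where "I = {i :: int ^ 'd. \<forall>l. i $ l \<in> {int (p $ l) + 1..(int (m $ l) - 1) * int (p $ l)}}"
  define C where "C = {b :: int ^ 'd. \<forall>l. b $ l \<in> {0..<int (m $ l)}}"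
  define C0 where "C0 = {b :: int ^ 'd. \<forall>l. b $ l \<in> {1..<int (m $ l) - 1}}"
  define block where "block b = (\<lambda>i. i + b * int_vec p) ` B" for b
  have fin: "finite B" "finite Q" "finite I" "finite C" "finite C0" "\<And>b. finite (block b)"
    unfolding B_def Q_def I_def C_def C0_def block_def
    by (intro finite_box finite_vec_Pi finite_imageI; simp)+
  have "C0 \<subseteq> C" by (auto simp: C0_def C_def) (smt (verit))+
  have "card C = (\<Prod>l\<in>UNIV. m $ l)" "card C0 = (\<Prod>l\<in>UNIV. m $ l - 2)"
    unfolding C_def C0_def card_vec_Pi by (auto intro!: prod.cong)
  then have cardC: "real (card (C - C0)) = real (\<Prod>l\<in>UNIV. m $ l) - real (\<Prod>l\<in>UNIV. m $ l - 2)"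
    using card_mono[OF fin(4) \<open>C0 \<subseteq> C\<close>] card_Diff_subset[OF fin(5) \<open>C0 \<subseteq> C\<close>]
    by (metis of_nat_diff)
  have cardI: "card I = (\<Prod>l\<in>UNIV. (m $ l - 2) * p $ l)"
  proof -
    \<comment> \<open>For \<open>a < 2\<close> the interval is empty and the truncated
      \<open>a - 2\<close> is 0, so both sides vanish.\<close>
    have *: "nat ((int a - 1) * int b - (int b + 1) + 1) = (a - 2) * b" for a b :: nat
    proof (cases "a \<ge> 2")
      case True
      then have "(int a - 1) * int b - (int b + 1) + 1 = int ((a - 2) * b)"
        by (simp add: of_nat_diff algebra_simps)
      then show ?thesis by (simp only: nat_int)
    next
      case False
      then have "(int a - 2) * int b \<le> 0" by (intro mult_nonpos_nonneg) auto
      then show ?thesis using False by (simp add: algebra_simps)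
    qed
    then show ?thesis unfolding I_def card_vec_Pi by (simp only: card_atLeastAtMost_int *)
  qed
  have cover: "i \<in> I \<or> (\<exists>b\<in>C - C0. i \<in> block b)" if "i \<in> Q" for i
  proof -
    \<comment> \<open>The index of the block containing \<open>i\<close>, shifted by 1 because boxes
      start at \<open>1\<close>. A site in \<open>Q\<close> forces every side of \<open>p\<close> to
      be positive, so the division is genuine.\<close>
    define b :: "int ^ 'd" where "b = (\<chi> l. (i $ l - 1) div int (p $ l))"
    have i: "1 \<le> i $ l" "i $ l \<le> int (m $ l) * int (p $ l)" for l
      using that by (auto simp: Q_def)
    have p: "int (p $ l) > 0" for l
      using i[of l] by (cases "p $ l = 0") auto
    have lo: "b $ l * int (p $ l) \<le> i $ l - 1" and hi: "i $ l - 1 < (b $ l + 1) * int (p $ l)" for l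
    proof -
      have "i $ l - 1 = b $ l * int (p $ l) + (i $ l - 1) mod int (p $ l)"
        by (simp add: b_def)
      moreover have "0 \<le> (i $ l - 1) mod int (p $ l)" "(i $ l - 1) mod int (p $ l) < int (p $ l)"
        using p[of l] by auto
      ultimately show "b $ l * int (p $ l) \<le> i $ l - 1" "i $ l - 1 < (b $ l + 1) * int (p $ l)"
        by (auto simp: algebra_simps)
    qed
    have "b $ l \<ge> 0" "b $ l < int (m $ l)" for l
    proof -
      show "b $ l \<ge> 0" using i[of l] p[of l] by (simp add: b_def pos_imp_zdiv_nonneg_iff)
      have "b $ l * int (p $ l) < int (m $ l) * int (p $ l)"
        using lo[of l] i[of l] by linarith
      then show "b $ l < int (m $ l)" using p[of l] by (simp add: mult_less_cancel_right)
    qed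
    then have "b \<in> C" by (auto simp: C_def)
    have "i - b * int_vec p \<in> B"
      using lo hi by (auto simp: B_def less_eq_vec_def int_vec_def algebra_simps)
        (smt (verit, ccfv_threshold))+
    then have "i \<in> block b" unfolding block_def by (intro image_eqI) auto
    have "i \<in> I" if "b \<in> C0"
    proof -
      have "i $ l \<in> {int (p $ l) + 1..(int (m $ l) - 1) * int (p $ l)}" for l
      proof -
        have bl: "1 \<le> b $ l" "b $ l + 1 \<le> int (m $ l) - 1"
          using that[unfolded C0_def mem_Collect_eq, rule_format, of l] by simp_all
        have "1 * int (p $ l) \<le> b $ l * int (p $ l)"
          "(b $ l + 1) * int (p $ l) \<le> (int (m $ l) - 1) * int (p $ l)"
          using bl by (intro mult_right_mono; simp)+
        then show ?thesis using lo[of l] hi[of l] by auto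
      qed
      then show ?thesis by (simp add: I_def)
    qed
    with \<open>b \<in> C\<close> \<open>i \<in> block b\<close> show ?thesis by blast
  qed
  \<comment> \<open>Sites of \<open>I\<close> have a margin of \<open>p\<close> to every face of
    \<open>Q\<close>, so their windows stay in \<open>Q\<close>.\<close>
  have inside: "j + i \<in> Q" if "i \<in> I" "j \<in> succ_box R p" for i j
  proof -
    have "- int (p $ l) \<le> j $ l" "j $ l \<le> int (p $ l)" "int (p $ l) + 1 \<le> i $ l"
      "i $ l \<le> (int (m $ l) - 1) * int (p $ l)" for l
      using that by (auto simp: I_def succ_box_def less_eq_vec_def int_vec_def)
    note * = this
    have "(j + i) $ l \<in> {1..int (m $ l) * int (p $ l)}" for l
      using *[of l] by (auto simp: algebra_simps)
    then show ?thesis unfolding Q_def by blast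
  qed
  have sub: "exceed c {i. 1 \<le> i \<and> i \<le> int_vec p'}
      \<subseteq> (\<Union>b\<in>C - C0. exceed c (block b)) \<union> (\<Union>i\<in>I. last_exceed c R p i)"
  proof
    fix \<omega> assume "\<omega> \<in> exceed c {i. 1 \<le> i \<and> i \<le> int_vec p'}"
    then obtain i0 where \<omega>: "\<omega> \<in> space M" and i0: "1 \<le> i0" "i0 \<le> int_vec p'" "X i0 \<omega> > c"
      by (auto simp: exceed_def)
    have "i0 \<in> Q"
    proof -
      have "i0 $ l \<le> int (m $ l) * int (p $ l)" for l
      proof -
        have "i0 $ l \<le> int (p' $ l)" using i0 by (simp add: less_eq_vec_def int_vec_def)
        also have "\<dots> \<le> int (m $ l * p $ l)" using p' by (simp only: of_nat_le_iff)
        finally show ?thesis by simp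
      qed
      then show ?thesis using i0 by (auto simp: Q_def less_eq_vec_def)
    qed
    then have "{i \<in> Q. X i \<omega> > c} \<noteq> {}" "finite {i \<in> Q. X i \<omega> > c}" using i0 fin by auto
    \<comment> \<open>The \<open>R\<close>-last exceedance is taken in all of \<open>Q\<close>, not
      only in \<open>[1, p']\<close>: if it lies in \<open>I\<close>, a later exceedance in its
      window would still be in \<open>Q\<close> and contradict the choice.\<close>
    from finite_linear_order_has_max[OF assms(1) this(2,1)]
    obtain i where i: "i \<in> Q" "X i \<omega> > c"
      and max: "\<And>j. j \<in> Q \<Longrightarrow> X j \<omega> > c \<Longrightarrow> (j, i) \<in> R" by auto
    have "\<omega> \<in> last_exceed c R p i" if "i \<in> I"
    proof -
      have "X (j + i) \<omega> \<le> c" if j: "j \<in> succ_box R p" for j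
      proof (rule ccontr)
        assume "\<not> X (j + i) \<omega> \<le> c"
        then have 1: "(j + i, i) \<in> R" using max inside[OF \<open>i \<in> I\<close> j] by auto
        have "(0 + i, j + i) \<in> R"
          using j assms(2) unfolding succ_box_def translation_invariant_def by blast
        moreover have "antisym R" using assms(1) by (simp add: order_on_defs)
        ultimately have "j + i = i" using 1 by (auto dest: antisymD)
        then show False using j by (simp add: succ_box_def)
      qed
      then show ?thesis using \<omega> i by (simp add: last_exceed_def)
    qed
    moreover have "\<omega> \<in> exceed c (block b)" if "i \<in> block b" for b
      using that \<omega> i by (auto simp: exceed_def)
    ultimately show "\<omega> \<in> (\<Union>b\<in>C - C0. exceed c (block b)) \<union> (\<Union>i\<in>I. last_exceed c R p i)"
      using cover[OF i(1)] by blast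
  qed
  have [simp]: "\<And>A. finite A \<Longrightarrow> exceed c A \<in> sets M" "\<And>i. last_exceed c R p i \<in> sets M"
    by (auto simp: sets_exceed sets_last_exceed)
  have "prob (exceed c {i. 1 \<le> i \<and> i \<le> int_vec p'})
      \<le> prob ((\<Union>b\<in>C - C0. exceed c (block b)) \<union> (\<Union>i\<in>I. last_exceed c R p i))"
    using fin by (intro finite_measure_mono sub sets.Un sets.finite_UN) auto
  also have "\<dots> \<le> prob (\<Union>b\<in>C - C0. exceed c (block b)) + prob (\<Union>i\<in>I. last_exceed c R p i)"
    using fin by (intro measure_Un_le sets.finite_UN) auto
  also have "\<dots> \<le> (\<Sum>b\<in>C - C0. prob (exceed c (block b))) + (\<Sum>i\<in>I. prob (last_exceed c R p i))"
    using fin by (intro add_mono finite_measure_subadditive_finite) auto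
  also have "\<dots> = real (card (C - C0)) * prob (exceed c B) + real (card I) * prob (last_exceed c R p 0)"
    unfolding block_def prob_exceed_shift[OF fin(1)] by (subst prob_last_exceed) simp
  finally show ?thesis unfolding cardC cardI B_def .
qed

end

section \<open>Asymptotics of block sizes and block counts\<close>

text \<open>Rounding costs less than \<open>k\<close>: with \<open>p = N div k\<close>,
  \<open>k * p \<le> N < k * p + k\<close>. Since \<open>k \<le> N / p\<close>, the relative error
  is at most \<open>1 / p\<close>, which tends to 0.\<close>

lemma real_div_mult_ratio_tendsto:
  fixes N k :: "nat \<Rightarrow> nat"
  assumes "filterlim (\<lambda>n. N n div k n) at_top sequentially"
  shows "(\<lambda>n. real (k n) * real (N n div k n) / real (N n)) \<longlonglongrightarrow> 1"
proof (rule tendsto_sandwich)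
  have ev: "eventually (\<lambda>n. N n div k n \<ge> 1) sequentially"
    using assms by (simp add: filterlim_at_top)
  have bounds: "1 - inverse (real (N n div k n)) \<le> real (k n) * real (N n div k n) / real (N n)"
    "real (k n) * real (N n div k n) / real (N n) \<le> 1" if p: "N n div k n \<ge> 1" for n
  proof -
    define p where "p = N n div k n"
    \<comment> \<open>Division by zero gives 0, so a quotient of at least 1 excludes
      \<open>k n = 0\<close> as well as \<open>N n = 0\<close>.\<close>
    have pos: "k n > 0" "N n > 0" "p \<ge> 1" using p by (auto simp: p_def intro!: Nat.gr0I)
    have le: "k n * p \<le> N n" by (simp add: p_def)
    have "N n < k n * p + k n"
      using mult_div_mod_eq[of "k n" "N n"] mod_less_divisor[OF pos(1), of "N n"]
      unfolding p_def by linarith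
    then have "real (N n) - real (k n) * real p \<le> real (k n)"
      by (metis less_imp_le of_nat_add of_nat_le_iff of_nat_mult diff_le_eq add.commute)
    then have "(real (N n) - real (k n) * real p) / real (N n) \<le> real (k n) / real (N n)"
      by (rule divide_right_mono) simp
    moreover have "real (k n) * real p \<le> real (N n)"
      using le by (metis of_nat_le_iff of_nat_mult)
    then have "real (k n) / real (N n) \<le> inverse (real p)"
      using pos by (simp add: field_simps)
    moreover have "1 - real (k n) * real p / real (N n) = (real (N n) - real (k n) * real p) / real (N n)"
      using pos by (simp add: diff_divide_distrib)
    ultimately show "1 - inverse (real (N n div k n)) \<le> real (k n) * real (N n div k n) / real (N n)"
      unfolding p_def[symmetric] by linarith
    show "real (k n) * real (N n div k n) / real (N n) \<le> 1"
      using pos \<open>real (k n) * real p \<le> real (N n)\<close> unfolding p_def[symmetric] by simp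
  qed
  show "eventually (\<lambda>n. 1 - inverse (real (N n div k n))
      \<le> real (k n) * real (N n div k n) / real (N n)) sequentially"
    "eventually (\<lambda>n. real (k n) * real (N n div k n) / real (N n) \<le> 1) sequentially"
    using ev by (eventually_elim, use bounds in blast)+
  have "filterlim (\<lambda>n. real (N n div k n)) at_top sequentially"
    by (rule filterlim_compose[OF filterlim_real_sequentially assms])
  from tendsto_diff[OF tendsto_const[of 1] tendsto_inverse_0_at_top[OF this]]
  show "(\<lambda>n. 1 - inverse (real (N n div k n))) \<longlonglongrightarrow> 1" by simp
qed simp

text \<open>Here \<open>m = p' div p + 1\<close> blocks of length \<open>p\<close> cover a block of length \<open>p'\<close>.\<close>

lemma block_count_ratio_tendsto:
  fixes N k k' :: "nat \<Rightarrow> nat"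
  defines "m \<equiv> \<lambda>n. (N n div k' n) div (N n div k n) + 1"
  assumes k': "\<And>n. 0 < k' n" "\<And>n. k' n \<le> k n"
    and k'k: "(\<lambda>n. real (k' n) / real (k n)) \<longlonglongrightarrow> 0"
    and p: "filterlim (\<lambda>n. N n div k n) at_top sequentially"
  shows "(\<lambda>n. real (k' n) * real (m n) / real (k n)) \<longlonglongrightarrow> 1"
    and "(\<lambda>n. real (k' n) * real (m n - 2) / real (k n)) \<longlonglongrightarrow> 1"
proof -
  have p': "filterlim (\<lambda>n. N n div k' n) at_top sequentially"
    by (rule filterlim_at_top_mono[OF p]) (use k' in \<open>auto intro!: always_eventually div_le_mono2\<close>)
  have ev: "eventually (\<lambda>n. N n div k n \<ge> 1) sequentially"
    using p by (simp add: filterlim_at_top)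
  \<comment> \<open>With block lengths \<open>p\<close> and \<open>p'\<close>,
    \<open>s = (k' / k) * (p' / p)\<close> is eventually the quotient of the ratios
    \<open>k' * p' / N\<close> and \<open>k * p / N\<close>, which both tend to 1.\<close>
  define s where "s = (\<lambda>n. real (k' n) / real (k n) * (real (N n div k' n) / real (N n div k n)))"
  have "(\<lambda>n. (real (k' n) * real (N n div k' n) / real (N n)) /
          (real (k n) * real (N n div k n) / real (N n))) \<longlonglongrightarrow> 1 / 1"
    by (intro tendsto_divide real_div_mult_ratio_tendsto p p') simp
  moreover have "eventually (\<lambda>n. (real (k' n) * real (N n div k' n) / real (N n)) /
          (real (k n) * real (N n div k n) / real (N n)) = s n) sequentially"
    using ev
  proof eventually_elim
    case (elim n)
    then have "N n > 0" by (auto intro!: Nat.gr0I)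
    then show ?case by (simp add: s_def field_simps)
  qed
  ultimately have s: "s \<longlonglongrightarrow> 1" by (simp add: tendsto_cong)
  show 1: "(\<lambda>n. real (k' n) * real (m n) / real (k n)) \<longlonglongrightarrow> 1"
  proof (rule tendsto_sandwich[OF _ _ s])
    \<comment> \<open>\<open>m\<close> exceeds \<open>p' / p\<close> by at most 1, which after the
      factor \<open>k' / k\<close> leaves an error tending to 0.\<close>
    have b: "real (N n div k' n) / real (N n div k n) \<le> real (m n)"
      "real (m n) \<le> real (N n div k' n) / real (N n div k n) + 1" if "N n div k n \<ge> 1" for n
    proof -
      have "real ((N n div k' n) mod (N n div k n)) / real (N n div k n) \<le> 1"
        using mod_less_divisor[of "N n div k n" "N n div k' n"] that
        by (intro divide_le_eq_1[THEN iffD2] disjI1) (auto simp del: mod_less_divisor)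
      then have "real (N n div k' n) / real (N n div k n) - 1 \<le> real ((N n div k' n) div (N n div k n))"
        using of_nat_of_nat_div_aux[where 'a = real, of "N n div k' n" "N n div k n"] by linarith
      then show "real (N n div k' n) / real (N n div k n) \<le> real (m n)" by (simp add: m_def)
      show "real (m n) \<le> real (N n div k' n) / real (N n div k n) + 1"
        using of_nat_div_le_of_nat[where 'a = real, of "N n div k' n" "N n div k n"] by (simp add: m_def)
    qed
    show "eventually (\<lambda>n. s n \<le> real (k' n) * real (m n) / real (k n)) sequentially"
      using ev
    proof eventually_elim
      case (elim n)
      have "s n \<le> real (k' n) / real (k n) * real (m n)"
        unfolding s_def by (intro mult_left_mono b elim) simp
      then show ?case by simp
    qed
    show "eventually (\<lambda>n. real (k' n) * real (m n) / real (k n)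
        \<le> s n + real (k' n) / real (k n)) sequentially"
      using ev
    proof eventually_elim
      case (elim n)
      have "real (k' n) / real (k n) * real (m n) \<le> real (k' n) / real (k n) *
          (real (N n div k' n) / real (N n div k n) + 1)"
        by (intro mult_left_mono b elim) simp
      then show ?case by (simp add: s_def algebra_simps)
    qed
    show "(\<lambda>n. s n + real (k' n) / real (k n)) \<longlonglongrightarrow> 1"
      using tendsto_add[OF s k'k] by simp
  qed
  have "(\<lambda>n. real (k' n) * real (m n) / real (k n) - 2 * (real (k' n) / real (k n))) \<longlonglongrightarrow> 1 - 2 * 0"
    by (intro tendsto_intros 1 k'k)
  moreover have "eventually (\<lambda>n. real (k' n) * real (m n) / real (k n) - 2 * (real (k' n) / real (k n))
      = real (k' n) * real (m n - 2) / real (k n)) sequentially"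
    using ev
  proof eventually_elim
    case (elim n)
    \<comment> \<open>From \<open>p' \<ge> p \<ge> 1\<close> it follows that
      \<open>m \<ge> 2\<close>, so \<open>m - 2\<close> is not truncated.\<close>
    have "N n div k n \<le> N n div k' n" using k' by (intro div_le_mono2)
    then have "(N n div k' n) div (N n div k n) \<ge> 1"
      using elim by (metis div_le_mono div_self not_one_le_zero)
    then have "real (m n - 2) = real (m n) - 2" by (simp add: m_def of_nat_diff)
    then show ?case by (simp add: algebra_simps diff_divide_distrib)
  qed
  ultimately show "(\<lambda>n. real (k' n) * real (m n - 2) / real (k n)) \<longlonglongrightarrow> 1"
    by (simp add: tendsto_cong)
qed

text \<open>The witness is \<open>sqrt k\<close> rounded up: it still tends to infinity and is
  \<open>o(k)\<close>, and as it is at most \<open>k\<close> it stays \<open>o(r)\<close> and can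
  only enlarge the blocks.\<close>

lemma admissible_refine:
  assumes "admissible N r k"
  obtains k' where "admissible N r k'" "\<And>n. 0 < k' n" "\<And>n. k' n \<le> k n"
    "(\<lambda>n. real (k' n) / real (k n)) \<longlonglongrightarrow> 0"
proof -
  define k' where "k' = (\<lambda>n. nat \<lceil>sqrt (real (k n))\<rceil>)"
  have k: "\<And>n. k n > 0" "filterlim k at_top sequentially" "(\<lambda>n. real (k n)) \<in> o(r)"
    "\<And>l. filterlim (\<lambda>n. block_size N k n $ l) at_top sequentially"
    using assms by (auto simp: admissible_def)
  have rk: "filterlim (\<lambda>n. real (k n)) at_top sequentially"
    by (rule filterlim_compose[OF filterlim_real_sequentially k(2)])
  have pos: "0 < k' n" for n using k(1)[of n] by (simp add: k'_def)
  have le: "k' n \<le> k n" for n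
  proof -
    have "sqrt (real (k n)) \<le> real (k n)"
      using k(1)[of n] by (intro real_le_lsqrt) (auto simp: power2_eq_square)
    then show ?thesis by (simp add: k'_def ceiling_le_iff)
  qed
  have ge: "sqrt (real (k n)) \<le> real (k' n)" for n
    by (simp add: k'_def)
  have le': "real (k' n) \<le> sqrt (real (k n)) + 1" for n
  proof -
    have "\<lceil>sqrt (real (k n))\<rceil> \<ge> 0" by (simp add: le_ceiling_iff) (smt (verit) real_sqrt_ge_zero of_nat_0_le_iff)
    then show ?thesis unfolding k'_def by simp
  qed
  have "filterlim (\<lambda>n. real (k' n)) at_top sequentially"
    by (rule filterlim_at_top_mono[OF filterlim_compose[OF sqrt_at_top rk]])
       (auto intro!: always_eventually ge)
  then have top: "filterlim k' at_top sequentially"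
    by (simp add: filterlim_sequentially_iff_filterlim_real)
  have "(\<lambda>n. real (k' n)) \<in> O(\<lambda>n. real (k n))"
    by (intro bigoI[of _ 1] always_eventually) (use le in simp)
  then have o: "(\<lambda>n. real (k' n)) \<in> o(r)" using k(3) by (rule landau_o.big_small_trans)
  have blk: "filterlim (\<lambda>n. block_size N k' n $ l) at_top sequentially" for l
    by (rule filterlim_at_top_mono[OF k(4)[of l]])
       (auto intro!: always_eventually div_le_mono2 pos le simp: block_size_def)
  have "(\<lambda>n. (sqrt (real (k n)) + 1) / real (k n)) \<longlonglongrightarrow> 0"
  proof -
    have "((\<lambda>x. (sqrt x + 1) / x) \<longlongrightarrow> 0) at_top" by real_asymp
    from filterlim_compose[OF this rk] show ?thesis .
  qed
  then have "(\<lambda>n. real (k' n) / real (k n)) \<longlonglongrightarrow> 0"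
    by (rule Lim_null_comparison[rotated])
       (auto intro!: always_eventually divide_right_mono le')
  then show ?thesis
    using that[of k'] pos le top o blk by (auto simp: admissible_def)
qed

section \<open>Passage between powers, logarithms and exponentials\<close>

text \<open>Since \<open>F\<close> is bounded away from 0, so eventually is
  \<open>(1 - q) ^ K\<close>, and logarithms may be taken. Then \<open>K * q\<close> is bounded, and
  replacing \<open>ln (1 - q)\<close> by \<open>- q\<close> costs at most a multiple of
  \<open>K * q^2 = (K * q)^2 / K\<close>, which vanishes.\<close>

lemma exponent_tendsto:
  fixes F q :: "nat \<Rightarrow> real" and K :: "nat \<Rightarrow> nat"
  assumes q: "\<And>n. 0 \<le> q n" "\<And>n. q n \<le> 1"
    and \<delta>: "\<delta> > 0" "eventually (\<lambda>n. F n \<ge> \<delta>) sequentially"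
    and K: "filterlim K at_top sequentially"
    and lim: "(\<lambda>n. F n - (1 - q n) ^ K n) \<longlonglongrightarrow> 0"
  shows "(\<lambda>n. real (K n) * q n + ln (F n)) \<longlonglongrightarrow> 0"
proof -
  define G where "G = (\<lambda>n. (1 - q n) ^ K n)"
  \<comment> \<open>Once \<open>G \<ge> \<delta> / 2\<close>, this bounds the exponent:
    \<open>K * q \<le> - ln G \<le> C\<close>.\<close>
  define C where "C = - ln (\<delta> / 2)"
  have rK: "filterlim (\<lambda>n. real (K n)) at_top sequentially"
    by (rule filterlim_compose[OF filterlim_real_sequentially K])
  have "eventually (\<lambda>n. K n \<ge> 1) sequentially" "eventually (\<lambda>n. real (K n) \<ge> 2 * C) sequentially"
    using K rK by (auto simp: filterlim_at_top)
  moreover have "eventually (\<lambda>n. \<bar>F n - G n\<bar> < \<delta> / 2) sequentially"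
    using tendstoD[OF lim, of "\<delta> / 2"] \<delta> by (simp add: G_def dist_real_def)
  ultimately have ev: "eventually (\<lambda>n. norm (real (K n) * q n + ln (F n))
      \<le> 2 * C\<^sup>2 * inverse (real (K n)) + 2 / \<delta> * \<bar>F n - G n\<bar>) sequentially"
    using \<delta>(2)
  proof eventually_elim
    case (elim n)
    have F: "F n \<ge> \<delta>" and G: "G n \<ge> \<delta> / 2" and K: "K n \<ge> 1" "real (K n) \<ge> 2 * C"
      using elim by (auto simp: abs_if split: if_splits)
    have q1: "1 - q n > 0"
    proof (rule ccontr)
      assume "\<not> 1 - q n > 0"
      then have "1 - q n = 0" using q(2)[of n] by linarith
      then have "G n = 0" using K by (simp add: G_def)
      then show False using G \<delta> by simp
    qed
    have lnG: "ln (G n) = real (K n) * ln (1 - q n)"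
      using q1 by (simp add: G_def ln_realpow)
    have "ln (1 - q n) \<le> - q n" using ln_add_one_self_le_self2[of "- q n"] q1 by simp
    then have up: "real (K n) * q n \<le> - ln (G n)"
      unfolding lnG by (metis mult_left_mono mult_minus_right neg_le_iff_le of_nat_0_le_iff minus_minus)
    have "ln (\<delta> / 2) \<le> ln (G n)" using G \<delta> by simp
    then have KqC: "real (K n) * q n \<le> C" using up by (simp add: C_def)
    \<comment> \<open>The eventual bound \<open>K \<ge> 2 * C\<close> yields
      \<open>q \<le> 1 / 2\<close>, the range of the quadratic lower bound for
      \<open>ln (1 - q)\<close>.\<close>
    have "2 * (real (K n) * q n) \<le> real (K n) * 1" using KqC K by linarith
    then have "q n \<le> 1 / 2" using K by simp
    then have "- q n - 2 * (q n)\<^sup>2 \<le> ln (1 - q n)"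
      using q by (intro ln_one_minus_pos_lower_bound)
    then have "real (K n) * (- q n - 2 * (q n)\<^sup>2) \<le> ln (G n)"
      unfolding lnG by (rule mult_left_mono) simp
    then have lo: "- (real (K n) * q n) - 2 * (real (K n) * (q n)\<^sup>2) \<le> ln (G n)"
      by (simp add: algebra_simps)
    have "real (K n) * (q n)\<^sup>2 = (real (K n) * q n)\<^sup>2 * inverse (real (K n))"
      using K by (simp add: field_simps power2_eq_square)
    also have "\<dots> \<le> C\<^sup>2 * inverse (real (K n))"
      using KqC q by (intro mult_right_mono power_mono) auto
    finally have 1: "\<bar>real (K n) * q n + ln (G n)\<bar> \<le> 2 * C\<^sup>2 * inverse (real (K n))"
      using lo up by linarith
    have pos: "F n > 0" "G n > 0" using F G \<delta> by linarith+
    \<comment> \<open>Both \<open>F\<close> and \<open>G\<close> are at least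
      \<open>\<delta> / 2\<close>, where the logarithm is Lipschitz with constant
      \<open>2 / \<delta>\<close>.\<close>
    have "ln (F n) - ln (G n) \<le> (F n - G n) / G n" using pos by (intro ln_diff_le)
    also have "\<dots> \<le> \<bar>F n - G n\<bar> / (\<delta> / 2)" using G \<delta> by (intro frac_le) auto
    finally have 2: "ln (F n) - ln (G n) \<le> 2 / \<delta> * \<bar>F n - G n\<bar>" by (simp add: field_simps)
    have "ln (G n) - ln (F n) \<le> (G n - F n) / F n" using pos by (intro ln_diff_le)
    also have "\<dots> \<le> \<bar>F n - G n\<bar> / (\<delta> / 2)" using F \<delta> by (intro frac_le) auto
    finally have 3: "ln (G n) - ln (F n) \<le> 2 / \<delta> * \<bar>F n - G n\<bar>" by (simp add: field_simps)
    show ?case using 1 2 3 by (simp add: abs_if split: if_splits)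
  qed
  have "(\<lambda>n. 2 * C\<^sup>2 * inverse (real (K n)) + 2 / \<delta> * \<bar>F n - G n\<bar>) \<longlonglongrightarrow> 2 * C\<^sup>2 * 0 + 2 / \<delta> * \<bar>0\<bar>"
    unfolding G_def by (intro tendsto_intros tendsto_inverse_0_at_top rK lim)
  then show ?thesis using ev by (intro Lim_null_comparison[OF ev]) simp
qed

text \<open>\<open>exp\<close> has slope at most 1 on the nonpositive half-line, which the tangent
  bound \<open>1 + t \<le> exp t\<close> makes explicit.\<close>

lemma exp_diff_le_of_nonpos:
  fixes x y :: real
  assumes "x \<le> 0" "y \<le> 0"
  shows "\<bar>exp x - exp y\<bar> \<le> \<bar>x - y\<bar>"
proof -
  have *: "exp a - exp b \<le> \<bar>a - b\<bar>" if "a \<le> 0" for a b :: real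
  proof -
    have "exp a * (1 + (b - a)) \<le> exp a * exp (b - a)"
      by (intro mult_left_mono exp_ge_add_one_self) auto
    then have "exp a - exp b \<le> exp a * (a - b)"
      by (simp add: exp_diff algebra_simps)
    also have "\<dots> \<le> exp a * \<bar>a - b\<bar>" by (intro mult_left_mono) auto
    also have "\<dots> \<le> 1 * \<bar>a - b\<bar>" using that by (intro mult_right_mono) auto
    finally show ?thesis by simp
  qed
  show ?thesis using *[OF assms(1), of y] *[OF assms(2), of x] by linarith
qed

text \<open>The limit argument stripped of probability: \<open>x\<close> and \<open>x'\<close> stand
  for \<open>k^d q(p)\<close> and \<open>k'^d q(p')\<close>, both close to \<open>- ln F\<close>,
  and \<open>A\<close> for \<open>n^d a(p)\<close>. As \<open>x\<close> and \<open>A\<close> are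
  eventually bounded, \<open>lower\<close> gives \<open>A \<le> - ln F + o(1)\<close> and
  \<open>upper\<close> gives \<open>- ln F \<le> A + o(1)\<close>; then \<open>exp\<close> is
  applied to \<open>ln F\<close> and \<open>- A\<close>.\<close>

lemma exp_sandwich_tendsto:
  fixes F A x x' u e1 e2 :: "nat \<Rightarrow> real"
  assumes F: "\<And>n. F n \<le> 1" and \<delta>: "\<delta> > 0" "eventually (\<lambda>n. F n \<ge> \<delta>) sequentially"
    and nonneg: "\<And>n. 0 \<le> A n" "\<And>n. 0 \<le> x n"
    and x: "(\<lambda>n. x n + ln (F n)) \<longlonglongrightarrow> 0" and x': "(\<lambda>n. x' n + ln (F n)) \<longlonglongrightarrow> 0"
    and u: "u \<longlonglongrightarrow> 1" and e: "e1 \<longlonglongrightarrow> 0" "e2 \<longlonglongrightarrow> 1"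
    and lower: "eventually (\<lambda>n. u n * A n \<le> x n) sequentially"
    and upper: "eventually (\<lambda>n. x' n \<le> e1 n * x n + e2 n * A n) sequentially"
  shows "(\<lambda>n. F n - exp (- A n)) \<longlonglongrightarrow> 0"
proof -
  \<comment> \<open>Eventually \<open>x\<close> is below \<open>1 - ln \<delta> = B / 2\<close>, and
    \<open>u > 1 / 2\<close> turns \<open>lower\<close> into
    \<open>A \<le> 2 * x \<le> B\<close>.\<close>
  define B where "B = 2 * (1 - ln \<delta>)"
  define E where "E = (\<lambda>n. \<bar>x n + ln (F n)\<bar> + \<bar>x' n + ln (F n)\<bar> +
    \<bar>1 - u n\<bar> * B + \<bar>e1 n\<bar> * B + \<bar>e2 n - 1\<bar> * B)"
  have "eventually (\<lambda>n. \<bar>x n + ln (F n)\<bar> < 1) sequentially"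
    using tendstoD[OF x, of 1] by (simp add: dist_real_def)
  moreover have "eventually (\<lambda>n. u n > 1 / 2) sequentially"
    by (rule order_tendstoD(1)[OF u]) simp
  ultimately have ev: "eventually (\<lambda>n. norm (F n - exp (- A n)) \<le> E n) sequentially"
    using lower upper \<delta>(2)
  proof eventually_elim
    case (elim n)
    have Fpos: "F n > 0" using elim \<delta> by linarith
    have "ln \<delta> \<le> ln (F n)" using elim \<delta> Fpos by simp
    then have xB: "x n \<le> B / 2" using elim(1) by (simp add: B_def abs_less_iff)
    have "1 / 2 * A n \<le> u n * A n" using elim(2) nonneg by (intro mult_right_mono) auto
    then have AB: "A n \<le> B" using elim(3) xB by linarith
    have xB': "x n \<le> B" using xB nonneg(2)[of n] by linarith
    have 1: "(1 - u n) * A n \<le> \<bar>1 - u n\<bar> * B" "e1 n * x n \<le> \<bar>e1 n\<bar> * B"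
      "(e2 n - 1) * A n \<le> \<bar>e2 n - 1\<bar> * B"
      using AB xB' nonneg[of n] by (auto intro!: mult_mono)
    have 2: "(1 - u n) * A n = A n - u n * A n" "(e2 n - 1) * A n = e2 n * A n - A n"
      by (simp_all add: algebra_simps)
    have nn: "0 \<le> \<bar>1 - u n\<bar> * B" "0 \<le> \<bar>e1 n\<bar> * B" "0 \<le> \<bar>e2 n - 1\<bar> * B"
      using xB' nonneg(2)[of n] by auto
    \<comment> \<open>The first bound passes through \<open>u * A \<le> x\<close>, the second
      through \<open>x' \<le> e1 * x + e2 * A\<close>.\<close>
    have "A n + ln (F n) \<le> E n" unfolding E_def using 1 2 nn elim by linarith
    moreover have "- (A n + ln (F n)) \<le> E n" unfolding E_def using 1 2 nn elim by linarith
    moreover have "\<bar>exp (ln (F n)) - exp (- A n)\<bar> \<le> \<bar>ln (F n) - (- A n)\<bar>"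
      using F[of n] Fpos nonneg[of n] by (intro exp_diff_le_of_nonpos) auto
    ultimately show ?case using Fpos by simp
  qed
  have "E \<longlonglongrightarrow> \<bar>0\<bar> + \<bar>0\<bar> + \<bar>1 - 1\<bar> * B + \<bar>0\<bar> * B + \<bar>1 - 1\<bar> * B"
    unfolding E_def by (intro tendsto_intros x x' u e)
  then show ?thesis by (intro Lim_null_comparison[OF ev]) simp
qed

section \<open>From the block factorization to the exponential formula\<close>

theorem theorem3p1:
  fixes M :: "'a measure"
    and X :: "int ^ 'd::finite \<Rightarrow> 'a \<Rightarrow> real"
    and R :: "(int ^ 'd) rel"
    and v :: "nat \<Rightarrow> real"
    and N :: "nat \<Rightarrow> nat ^ 'd"
    and r :: "nat \<Rightarrow> real"
  assumes "prob_space M"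
    and "\<And>i. X i \<in> borel_measurable M"
    and "stationary_field M X"
    and "linear_order R"
    and "translation_invariant R"
    and "\<And>l. filterlim (\<lambda>n. N n $ l) at_top sequentially"
    and "(\<lambda>n. \<Prod>l\<in>UNIV. real (N n $ l)) \<sim>[sequentially] (\<lambda>n. real n ^ CARD('d))"
    and "filterlim r at_top sequentially"
    and "\<And>k. admissible N r k \<Longrightarrow>
           (\<lambda>n. \<P>(\<omega> in M. max_box X (N n) \<omega> \<le> ereal (v n))
                - \<P>(\<omega> in M. max_box X (block_size N k n) \<omega> \<le> ereal (v n)) ^ (k n ^ CARD('d)))
             \<in> o(\<lambda>_. 1)"
    and "liminf (\<lambda>n. ereal (\<P>(\<omega> in M. max_box X (N n) \<omega> \<le> ereal (v n)))) > 0"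
  shows "\<forall>k. admissible N r k \<longrightarrow>
           (\<lambda>n. \<P>(\<omega> in M. max_box X (N n) \<omega> \<le> ereal (v n))
                - exp (- (real n ^ CARD('d) *
                    \<P>(\<omega> in M. X 0 \<omega> > v n \<and>
                               max_on X (succ_box R (block_size N k n)) \<omega> \<le> ereal (v n)))))
             \<in> o(\<lambda>_. 1)"
proof (intro allI impI)
  fix k assume adm: "admissible N r k"
  interpret stationary_random_field M X
    using assms(1-3) by (simp add: stationary_random_field_def stationary_random_field_axioms_def)
  obtain k' where k': "admissible N r k'" "\<And>n. 0 < k' n" "\<And>n. k' n \<le> k n"
    "(\<lambda>n. real (k' n) / real (k n)) \<longlonglongrightarrow> 0"
    using admissible_refine[OF adm] by blast
  have kpos: "k n > 0" for n using adm by (simp add: admissible_def)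
  define K where "K = (\<lambda>k (n::nat). (k n :: nat) ^ CARD('d))"
  define F where "F = (\<lambda>n. \<P>(\<omega> in M. max_box X (N n) \<omega> \<le> ereal (v n)))"
  define q where "q = (\<lambda>k n. prob (exceed (v n) {i. 1 \<le> i \<and> i \<le> int_vec (block_size N k n)}))"
  define a where "a = (\<lambda>n. prob (last_exceed (v n) R (block_size N k n) 0))"
  define A where "A = (\<lambda>n. real n ^ CARD('d) * a n)"
  define m where "m = (\<lambda>n. \<chi> l. block_size N k' n $ l div block_size N k n $ l + 1)"
  \<comment> \<open>Eventually \<open>P * D\<close> equals \<open>k^d p_1 ... p_d / n^d\<close>.
    \<open>W\<close> measures the number of covering blocks against \<open>(k / k')^d\<close>, and
    \<open>W0\<close> does so for the inner blocks. All these tend to 1, so the share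
    \<open>W - W0\<close> of the boundary blocks tends to 0.\<close>
  define P where "P = (\<lambda>n. \<Prod>l\<in>UNIV. real (k n) * real (block_size N k n $ l) / real (N n $ l))"
  define W where "W = (\<lambda>n. \<Prod>l\<in>UNIV. real (k' n) * real (m n $ l) / real (k n))"
  define W0 where "W0 = (\<lambda>n. \<Prod>l\<in>UNIV. real (k' n) * real (m n $ l - 2) / real (k n))"
  define D where "D = (\<lambda>n. (\<Prod>l\<in>UNIV. real (N n $ l)) / real n ^ CARD('d))"
  have blk: "filterlim (\<lambda>n. N n $ l div k n) at_top sequentially" for l
    using adm by (simp add: admissible_def block_size_def)
  have D: "D \<longlonglongrightarrow> 1"
    unfolding D_def using assms(7)
    by (intro asymp_equivD_strong) (auto intro: eventually_mono[OF eventually_gt_at_top[of 0]])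
  have P: "P \<longlonglongrightarrow> 1"
  proof -
    have "P \<longlonglongrightarrow> (\<Prod>l\<in>(UNIV :: 'd set). 1)"
      unfolding P_def block_size_def by (intro tendsto_prod) (simp add: real_div_mult_ratio_tendsto blk)
    then show ?thesis by simp
  qed
  have W: "W \<longlonglongrightarrow> 1" "W0 \<longlonglongrightarrow> 1"
  proof -
    have "W \<longlonglongrightarrow> (\<Prod>l\<in>(UNIV :: 'd set). 1)" "W0 \<longlonglongrightarrow> (\<Prod>l\<in>(UNIV :: 'd set). 1)"
      unfolding W_def W0_def m_def block_size_def
      by (intro tendsto_prod, simp only: vec_lambda_beta,
          rule block_count_ratio_tendsto[OF k'(2,3,4) blk])+
    then show "W \<longlonglongrightarrow> 1" "W0 \<longlonglongrightarrow> 1" by simp_all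
  qed
  obtain \<delta> where \<delta>: "\<delta> > 0" "eventually (\<lambda>n. F n \<ge> \<delta>) sequentially"
  proof -
    \<comment> \<open>\<open>y\<close> lies strictly below the limit inferior, hence is an eventual
      lower bound; the real \<open>d\<close> below it serves as \<open>\<delta>\<close>.\<close>
    obtain y where y: "0 < y" "y < liminf (\<lambda>n. ereal (F n))"
      using assms(10) dense unfolding F_def by blast
    obtain d where d: "0 < d" "ereal d < y"
      using ereal_dense2[OF y(1)] by (metis ereal_less(2))
    have "eventually (\<lambda>n. y < ereal (F n)) sequentially" using y(2) by (rule less_LiminfD)
    then have "eventually (\<lambda>n. F n \<ge> d) sequentially"
    proof eventually_elim
      case (elim n)
      with d(2) have "ereal d < ereal (F n)" by (rule less_trans)
      then show ?case by simp
    qed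
    with d(1) show ?thesis by (rule that)
  qed
  \<comment> \<open>Stated for a general admissible \<open>h\<close> because it is applied both to
    \<open>k\<close> and to the refinement \<open>k'\<close>.\<close>
  have Kq: "(\<lambda>n. real (K h n) * q h n + ln (F n)) \<longlonglongrightarrow> 0" if h: "admissible N r h" for h
  proof (rule exponent_tendsto[OF _ _ \<delta>])
    show "0 \<le> q h n" "q h n \<le> 1" for n by (simp_all add: q_def)
    have "h n \<le> K h n" for n
      using h unfolding K_def admissible_def by (intro self_le_power) (auto simp: Suc_le_eq)
    then have "eventually (\<lambda>n. h n \<le> K h n) sequentially" by (simp only: eventually_True)
    moreover have "filterlim h at_top sequentially" using h unfolding admissible_def by blast
    ultimately show "filterlim (K h) at_top sequentially" by (rule filterlim_at_top_mono[rotated])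
    show "(\<lambda>n. F n - (1 - q h n) ^ K h n) \<longlonglongrightarrow> 0"
      using smalloD_tendsto[OF assms(9)[OF h]]
      unfolding F_def q_def K_def prob_max_box diff_diff_eq2 div_by_1 by (simp only: add_diff_cancel_left')
  qed
  have ev_pos: "eventually (\<lambda>n. f n > 0) sequentially" if "filterlim f at_top sequentially"
    for f :: "nat \<Rightarrow> nat"
    using that eventually_gt_at_top[of "0 :: nat"] unfolding filterlim_iff by blast
  have ev: "eventually (\<lambda>n. n > 0 \<and> (\<forall>l. N n $ l > 0) \<and> (\<forall>l. block_size N k n $ l > 0)) sequentially"
    unfolding block_size_def vec_lambda_beta
    by (intro eventually_conj eventually_gt_at_top eventually_all_finite ev_pos assms(6) blk)
  have PD: "P n * D n = real (K k n) * real (\<Prod>l\<in>UNIV. block_size N k n $ l) / real n ^ CARD('d)"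
    if "\<forall>l. N n $ l > 0" for n
    using that by (simp add: P_def D_def K_def prod.distrib prod_dividef)
  have "(\<lambda>n. F n - exp (- A n)) \<longlonglongrightarrow> 0"
  \<comment> \<open>The data are \<open>u = P * D\<close>, \<open>e1 = W - W0\<close> and
    \<open>e2 = W0 * (P * D)\<close>, with \<open>x\<close> and \<open>x'\<close> belonging to
    \<open>k\<close> and \<open>k'\<close>.\<close>
  proof (rule exp_sandwich_tendsto[OF _ \<delta> _ _ Kq[OF adm] Kq[OF k'(1)]])
    show "F n \<le> 1" "0 \<le> A n" "0 \<le> real (K k n) * q k n" for n
      by (simp_all add: F_def A_def a_def q_def)
    show "(\<lambda>n. P n * D n) \<longlonglongrightarrow> 1" "(\<lambda>n. W0 n * (P n * D n)) \<longlonglongrightarrow> 1" "(\<lambda>n. W n - W0 n) \<longlonglongrightarrow> 0"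
      using tendsto_mult[OF P D] tendsto_mult[OF W(2) tendsto_mult[OF P D]]
        tendsto_diff[OF W] by simp_all
    show "eventually (\<lambda>n. P n * D n * A n \<le> real (K k n) * q k n) sequentially"
      using ev
    proof eventually_elim
      case (elim n)
      then have PDn: "P n * D n = real (K k n) * real (\<Prod>l\<in>UNIV. block_size N k n $ l) / real n ^ CARD('d)"
        using PD by blast
      have "P n * D n * A n =
          real (K k n) * (real (\<Prod>l\<in>UNIV. block_size N k n $ l) * a n)"
        unfolding PDn A_def using elim by simp
      also have "\<dots> \<le> real (K k n) * q k n"
        unfolding q_def a_def by (intro mult_left_mono prob_exceed_box_ge assms) simp
      finally show ?case .
    qed
    show "eventually (\<lambda>n. real (K k' n) * q k' n
        \<le> (W n - W0 n) * (real (K k n) * q k n) + W0 n * (P n * D n) * A n) sequentially"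
      using ev
    proof eventually_elim
      case (elim n)
      have m: "block_size N k' n $ l \<le> m n $ l * block_size N k n $ l" for l
        using dividend_less_div_times[of "block_size N k n $ l" "block_size N k' n $ l"]
        elim by (simp add: m_def)
      have PDn: "P n * D n = real (K k n) * real (\<Prod>l\<in>UNIV. block_size N k n $ l) / real n ^ CARD('d)"
        using PD elim by blast
      have Kpos: "real (K k n) > 0" using kpos by (simp add: K_def)
      \<comment> \<open>Block counts times \<open>k'^d\<close> become multiples of
        \<open>k^d\<close>, so that boundary blocks are weighed against \<open>k^d q(p)\<close> and
        interior sites against \<open>A\<close>.\<close>
      have W_eq: "real (K k' n) * real (\<Prod>l\<in>UNIV. m n $ l) = W n * real (K k n)"
        "real (K k' n) * real (\<Prod>l\<in>UNIV. m n $ l - 2) = W0 n * real (K k n)"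
        using Kpos by (simp_all add: W_def W0_def K_def prod.distrib prod_dividef)
      have "real (K k' n) * q k' n \<le> real (K k' n) *
         ((real (\<Prod>l\<in>UNIV. m n $ l) - real (\<Prod>l\<in>UNIV. m n $ l - 2)) * q k n
           + real (\<Prod>l\<in>UNIV. (m n $ l - 2) * block_size N k n $ l) * a n)"
        unfolding q_def a_def by (intro mult_left_mono prob_exceed_box_le assms m) simp
      also have "\<dots> = (real (K k' n) * real (\<Prod>l\<in>UNIV. m n $ l) -
            real (K k' n) * real (\<Prod>l\<in>UNIV. m n $ l - 2)) * q k n +
          real (K k' n) * real (\<Prod>l\<in>UNIV. m n $ l - 2) *
            real (\<Prod>l\<in>UNIV. block_size N k n $ l) * a n"
        by (simp only: prod.distrib of_nat_mult left_diff_distrib right_diff_distrib distrib_left mult.assoc)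
      also have "\<dots> = (W n - W0 n) * (real (K k n) * q k n) + W0 n * (P n * D n) * A n"
        unfolding W_eq PDn A_def using elim by (simp add: algebra_simps)
      finally show ?case .
    qed
  qed
  then show "(\<lambda>n. \<P>(\<omega> in M. max_box X (N n) \<omega> \<le> ereal (v n))
                - exp (- (real n ^ CARD('d) *
                    \<P>(\<omega> in M. X 0 \<omega> > v n \<and>
                               max_on X (succ_box R (block_size N k n)) \<omega> \<le> ereal (v n)))))
             \<in> o(\<lambda>_. 1)"
    by (intro smalloI_tendsto) (simp_all add: F_def A_def a_def last_exceed_def max_on_le_iff)
qed

end
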